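(* Let $E,F$ be Banach spaces, let $1\le p<\infty$, and let $T\in\mathcal L(E;F)$. If the adjoint $T^*\colon F^*\to E^*$ is absolutely $p$-summing, then $T\in W_{s,p;s}^{\mathrm{mid}}(E;F)$ for all $s\in[p,\infty)$, and $\|T\|_{W_{s,p;s}^{\mathrm{mid}}}\le\pi_p(T^* )$.
   Context: Banach spaces are over $\mathbb K=\mathbb R$ or $\mathbb C$; $\mathcal L(E;F)$ is the space of continuous linear operators. For $1\le p<\infty$, $\ell_p^w(E)$ is the space of sequences $(x_j)_{j=1}^\infty$ in $E$ with $\|(x_j)_j\|_{w,p}:=\sup_{\varphi\in B_{E^*}}(\sum_{j}|\varphi(x_j)|^p)^{1/p}<\infty$. An operator is absolutely $p$-summing if it maps weakly $p$-summable sequences to absolutely $p$-summable ones, and $\pi_p$ is the usual $p$-summing norm. For $1\le q,p<\infty$, $\ell_{q,p}^{\mathrm{mid}}(E)$ is the space of sequences $(x_j)_{j=1}^\infty$ in $E$ with $\sum_{j=1}^\infty\left(\sum_{n=1}^\infty|x_n^*(x_j)|^p\right)^{q/p}<\infty$ for every $(x_n^* )_n\in\ell_p^w(E^* )$, with norm $$\|(x_j)_{j=1}^\infty\|_{q,p}:=\sup_{(x_n^* )_n\in B_{\ell_p^w(E^* )}}\left(\sum_{j=1}^\infty\left(\sum_{n=1}^\infty|x_n^*(x_j)|^p\right)^{q/p}\right)^{1/q}.$$ For $1\le r\le q<\infty$, $W_{q,p;r}^{\mathrm{mid}}(E;F)$ is the set of $T\in\mathcal L(E;F)$ (called weakly mid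 $(q,p;r)$-summing) such that $(T(x_j))_j\in\ell_{q,p}^{\mathrm{mid}}(F)$ whenever $(x_j)_j\in\ell_r^w(E)$; $\|T\|_{W_{q,p;r}^{\mathrm{mid}}}$ is the operator norm of the induced map $\ell_r^w(E)\to\ell_{q,p}^{\mathrm{mid}}(F)$, $(x_j)_j\mapsto(T(x_j))_j$. *)

theory Defs
  imports "HOL-Analysis.Analysis" "HOL-Library.Function_Algebras"
begin

(* The scalar field is a type 'k :: {real_normed_field, euclidean_space}.  Both real and complex
   belong to this sort, and by the theorem of Gelfand-Mazur (or Frobenius) every type of this sort
   is isometrically isomorphic to one of them.

   A normed space over 'k is given by a carrier, a scalar multiplication and a norm; its addition
   is that of the ambient type.  Spaces are carriers rather than types because iterated duals
   are spaces of 'k-linear functionals for an explicitly given scalar multiplication. *)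

record ('k, 'v) nspace =
  pts :: "'v set"
  scl :: "'k \<Rightarrow> 'v \<Rightarrow> 'v"
  nrm :: "'v \<Rightarrow> real"

definition normed_space ::
  "('k::{real_normed_field,euclidean_space}, 'v::ab_group_add) nspace \<Rightarrow> bool" where
  "normed_space X \<longleftrightarrow>
     vector_space (scl X) \<and> module.subspace (scl X) (pts X) \<and>
     (\<forall>x\<in>pts X. 0 \<le> nrm X x \<and> (nrm X x = 0 \<longleftrightarrow> x = 0)) \<and>
     (\<forall>x\<in>pts X. \<forall>y\<in>pts X. nrm X (x + y) \<le> nrm X x + nrm X y) \<and>
     (\<forall>c. \<forall>x\<in>pts X. nrm X (scl X c x) = norm c * nrm X x)"

(* The library predicate mcomplete expects a metric that is symmetric and nonnegative on the
   whole ambient type, whereas nrm X is unconstrained outside the carrier. *)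
definition banach_space ::
  "('k::{real_normed_field,euclidean_space}, 'v::ab_group_add) nspace \<Rightarrow> bool" where
  "banach_space X \<longleftrightarrow> normed_space X \<and>
     Metric_space.mcomplete (pts X)
       (\<lambda>x y. if x \<in> pts X \<and> y \<in> pts X then nrm X (x - y) else 0)"

definition unit_ball :: "('k, 'v) nspace \<Rightarrow> 'v set" where
  "unit_ball X = {x \<in> pts X. nrm X x \<le> 1}"

definition scalar_space :: "('k::{real_normed_field,euclidean_space}, 'k) nspace" where
  "scalar_space = \<lparr>pts = UNIV, scl = (*), nrm = norm\<rparr>"

(* The value 0 outside the carrier makes an operator determined by its restriction to the
   carrier, and is preserved by pointwise addition and scalar multiplication. *)
definition bounded_ops ::
  "('k, 'v::ab_group_add) nspace \<Rightarrow> ('k, 'w::ab_group_add) nspace \<Rightarrow> ('v \<Rightarrow> 'w) set" where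
  "bounded_ops X Y = {T.
     (\<forall>x\<in>pts X. T x \<in> pts Y) \<and> (\<forall>x. x \<notin> pts X \<longrightarrow> T x = 0) \<and>
     (\<forall>x\<in>pts X. \<forall>y\<in>pts X. T (x + y) = T x + T y) \<and>
     (\<forall>c. \<forall>x\<in>pts X. T (scl X c x) = scl Y c (T x)) \<and>
     (\<exists>C. \<forall>x\<in>pts X. nrm Y (T x) \<le> C * nrm X x)}"

definition dual ::
  "('k::{real_normed_field,euclidean_space}, 'v::ab_group_add) nspace \<Rightarrow> ('k, 'v \<Rightarrow> 'k) nspace" where
  "dual X = \<lparr>pts = bounded_ops X scalar_space,
             scl = (\<lambda>c \<phi> x. c * \<phi> x),
             nrm = (\<lambda>\<phi>. SUP x\<in>unit_ball X. norm (\<phi> x))\<rparr>"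

(* The adjoint of T in L(E;F).  Since T vanishes outside the carrier of E,
   so does the composition of T with a functional. *)
definition adjoint_op ::
  "('k::{real_normed_field,euclidean_space}, 'w::ab_group_add) nspace \<Rightarrow> ('v \<Rightarrow> 'w) \<Rightarrow>
     ('w \<Rightarrow> 'k) \<Rightarrow> ('v \<Rightarrow> 'k)" where
  "adjoint_op F T \<phi> = (if \<phi> \<in> pts (dual F) then \<phi> \<circ> T else 0)"

(* Finiteness of a supremum of series is expressed by convergence of each series and boundedness
   of their values, since Sup and suminf are real-valued. *)
definition weak_lp ::
  "real \<Rightarrow> ('k::{real_normed_field,euclidean_space}, 'v::ab_group_add) nspace \<Rightarrow> (nat \<Rightarrow> 'v) set" where
  "weak_lp p X = {x. (\<forall>j. x j \<in> pts X) \<and>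
     (\<forall>\<phi>\<in>unit_ball (dual X). summable (\<lambda>j. norm (\<phi> (x j)) powr p)) \<and>
     bdd_above ((\<lambda>\<phi>. (\<Sum>j. norm (\<phi> (x j)) powr p) powr (1 / p)) ` unit_ball (dual X))}"

definition weak_norm ::
  "real \<Rightarrow> ('k::{real_normed_field,euclidean_space}, 'v::ab_group_add) nspace \<Rightarrow> (nat \<Rightarrow> 'v) \<Rightarrow> real" where
  "weak_norm p X x = (SUP \<phi>\<in>unit_ball (dual X). (\<Sum>j. norm (\<phi> (x j)) powr p) powr (1 / p))"

definition weak_ball ::
  "real \<Rightarrow> ('k::{real_normed_field,euclidean_space}, 'v::ab_group_add) nspace \<Rightarrow> (nat \<Rightarrow> 'v) set" where
  "weak_ball p X = {x \<in> weak_lp p X. weak_norm p X x \<le> 1}"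

definition abs_summing ::
  "real \<Rightarrow> ('k::{real_normed_field,euclidean_space}, 'v::ab_group_add) nspace \<Rightarrow>
     ('k, 'w::ab_group_add) nspace \<Rightarrow> ('v \<Rightarrow> 'w) \<Rightarrow> bool" where
  "abs_summing p X Y u \<longleftrightarrow> u \<in> bounded_ops X Y \<and>
     (\<forall>x\<in>weak_lp p X. summable (\<lambda>j. nrm Y (u (x j)) powr p))"

(* The least constant in the defining inequality over finite families. *)
definition summing_norm ::
  "real \<Rightarrow> ('k::{real_normed_field,euclidean_space}, 'v::ab_group_add) nspace \<Rightarrow>
     ('k, 'w::ab_group_add) nspace \<Rightarrow> ('v \<Rightarrow> 'w) \<Rightarrow> real" where
  "summing_norm p X Y u = Inf {C. 0 \<le> C \<and>
     (\<forall>(m::nat) x. (\<forall>j<m. x j \<in> pts X) \<longrightarrow>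
        (\<Sum>j<m. nrm Y (u (x j)) powr p) powr (1 / p)
          \<le> C * (SUP \<phi>\<in>unit_ball (dual X). (\<Sum>j<m. norm (\<phi> (x j)) powr p) powr (1 / p)))}"

definition mid_lp ::
  "real \<Rightarrow> real \<Rightarrow> ('k::{real_normed_field,euclidean_space}, 'v::ab_group_add) nspace \<Rightarrow> (nat \<Rightarrow> 'v) set" where
  "mid_lp q p X = {x. (\<forall>j. x j \<in> pts X) \<and>
     (\<forall>\<psi>\<in>weak_lp p (dual X).
        (\<forall>j. summable (\<lambda>n. norm (\<psi> n (x j)) powr p)) \<and>
        summable (\<lambda>j. (\<Sum>n. norm (\<psi> n (x j)) powr p) powr (q / p)))}"

definition mid_norm ::
  "real \<Rightarrow> real \<Rightarrow> ('k::{real_normed_field,euclidean_space}, 'v::ab_group_add) nspace \<Rightarrow> (nat \<Rightarrow> 'v) \<Rightarrow> real" where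
  "mid_norm q p X x = (SUP \<psi>\<in>weak_ball p (dual X).
     (\<Sum>j. (\<Sum>n. norm (\<psi> n (x j)) powr p) powr (q / p)) powr (1 / q))"

definition weakly_mid_summing ::
  "real \<Rightarrow> real \<Rightarrow> real \<Rightarrow> ('k::{real_normed_field,euclidean_space}, 'v::ab_group_add) nspace \<Rightarrow>
     ('k, 'w::ab_group_add) nspace \<Rightarrow> ('v \<Rightarrow> 'w) set" where
  "weakly_mid_summing q p r E F =
     {T \<in> bounded_ops E F. \<forall>x\<in>weak_lp r E. (\<lambda>j. T (x j)) \<in> mid_lp q p F}"

definition weakly_mid_norm ::
  "real \<Rightarrow> real \<Rightarrow> real \<Rightarrow> ('k::{real_normed_field,euclidean_space}, 'v::ab_group_add) nspace \<Rightarrow>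
     ('k, 'w::ab_group_add) nspace \<Rightarrow> ('v \<Rightarrow> 'w) \<Rightarrow> real" where
  "weakly_mid_norm q p r E F T = (SUP x\<in>weak_ball r E. mid_norm q p F (\<lambda>j. T (x j)))"

end

theory Submission
  imports Defs
begin

text \<open>
  Let \<open>\<psi>\<close> be a sequence in the dual of \<open>F\<close> and \<open>x\<close> a sequence in \<open>E\<close>, both of weak norm at
  most 1, for the exponents \<open>p\<close> and \<open>s\<close> respectively. The functionals \<open>f n = \<psi> n \<circ> T\<close> on \<open>E\<close>
  are the images of the \<open>\<psi> n\<close> under the adjoint of \<open>T\<close>, so \<open>\<Sum>n. \<parallel>f n\<parallel>\<^sup>p\<close> is at most the
  \<open>p\<close>-th power of the summing norm of the adjoint. The mid norm of \<open>T \<circ> x\<close> is a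
  supremum over \<open>\<psi>\<close> of quantities whose \<open>p\<close>-th power is the \<open>\<ell>\<close>-norm with exponent \<open>s / p \<ge> 1\<close>, in the
  index \<open>j\<close>, of the sum over \<open>n\<close> of the nonnegative sequences \<open>j \<mapsto> \<bar>f n (x j)\<bar>\<^sup>p\<close>. By Minkowski's
  inequality this norm is at most the sum over \<open>n\<close> of the norms of these sequences. The \<open>n\<close>-th
  of them is \<open>\<Sum>j. \<bar>f n (x j)\<bar>\<^sup>s\<close> raised to the power \<open>p / s\<close>, which is at most \<open>\<parallel>f n\<parallel>\<^sup>p\<close>
  because \<open>x\<close> has weak norm at most 1. This is \<open>mixed_norm_functionals\<close>, and no constant is lost.

  The summing norm is an infimum over constants valid for finite families, whereas absolute
  summability is a qualitative statement about infinite sequences. That an admissible constant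
  exists at all is \<open>abs_summing_finite_inequality\<close>: if there were none, finite families violating
  the inequality ever more strongly could be glued into one weakly summable sequence with a
  divergent image. Without it the infimum would be that of the empty set and bound nothing.
\<close>

section \<open>Minkowski's inequality for series of nonnegative reals\<close>

text \<open>
  The second-derivative criterion gives convexity on the open half-line only; the end point, needed
  because the series below may have zero terms, is covered by \<open>c\<^sup>r \<le> c\<close> for \<open>0 < c < 1\<close>.
\<close>

lemma convex_on_powr_nonneg:
  fixes r :: real
  assumes "1 \<le> r"
  shows "convex_on {0..} (\<lambda>x::real. x powr r)"
proof (rule convex_onI)
  fix t x y :: real
  assume t: "0 < t" "t < 1" and xy: "x \<in> {0..}" "y \<in> {0..}"
  have le: "c powr r * z powr r \<le> c * z powr r" if "0 < c" "c < 1" for c z :: real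
    using powr_mono'[of 1 r c] that assms by (intro mult_right_mono) auto
  consider "x = 0" | "y = 0" | "0 < x" "0 < y"
    using xy by fastforce
  then show "((1 - t) *\<^sub>R x + t *\<^sub>R y) powr r \<le> (1 - t) * x powr r + t * y powr r"
  proof cases
    case 1
    then show ?thesis
      using le[OF t, of y] t xy by (simp add: powr_mult)
  next
    case 2
    then show ?thesis
      using le[of "1 - t" x] t xy by (simp add: powr_mult)
  next
    case 3
    then show ?thesis
      using convex_onD[OF powr_convex[OF assms], of t x y] t by simp
  qed
qed (rule convex_real_interval)

text \<open>
  With \<open>S = \<Sum>n\<in>A. L n\<close>, the inner sum is a convex combination, with weights \<open>L n / S\<close>, of the numbers
  \<open>S * a n j / L n\<close>. Jensen's inequality for the \<open>r\<close>-th power, followed by an interchange of the two sums,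
  reduces the claim to the given bounds on the individual sequences. The numbers \<open>L n\<close> stand for bounds
  of the \<open>\<ell>\<close>-norms, up to the common factor \<open>K\<close>; using bounds instead of the norms themselves lets
  \<open>\<parallel>f n\<parallel>\<^sup>p\<close> be plugged in directly.
\<close>

lemma minkowski_finite:
  fixes a :: "'n \<Rightarrow> 'j \<Rightarrow> real" and L :: "'n \<Rightarrow> real"
  assumes "finite A" "1 \<le> r" and a: "\<And>n j. n \<in> A \<Longrightarrow> j \<in> B \<Longrightarrow> 0 \<le> a n j" and L: "\<And>n. n \<in> A \<Longrightarrow> 0 \<le> L n"
    and "finite B" "0 \<le> K"
    and le: "\<And>n. n \<in> A \<Longrightarrow> (\<Sum>j\<in>B. a n j powr r) \<le> K * L n powr r"
  shows "(\<Sum>j\<in>B. (\<Sum>n\<in>A. a n j) powr r) \<le> K * (\<Sum>n\<in>A. L n) powr r"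
proof -
  \<comment> \<open>Where the weight vanishes so does the whole sequence, so the quotients by \<open>L n = 0\<close>, which are 0,
      have the intended value.\<close>
  have zero: "a n j = 0" if "n \<in> A" "j \<in> B" "L n = 0" for n j
  proof -
    have "(\<Sum>j\<in>B. a n j powr r) \<le> 0"
      using le[OF that(1)] that(3) by simp
    then have "a n j powr r = 0"
      using sum_nonneg_eq_0_iff[OF \<open>finite B\<close>, of "\<lambda>j. a n j powr r"] \<open>j \<in> B\<close> sum_nonneg[of B "\<lambda>j. a n j powr r"]
      by force
    then show ?thesis by simp
  qed
  define S where "S = (\<Sum>n\<in>A. L n)"
  show ?thesis
  proof (cases "S = 0")
    case True
    then have "L n = 0" if "n \<in> A" for n
      using that sum_nonneg_eq_0_iff[OF \<open>finite A\<close>, of L] L unfolding S_def by auto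
    then have "(\<Sum>n\<in>A. a n j) = 0" if "j \<in> B" for j
      using zero that by simp
    then show ?thesis
      using \<open>0 \<le> K\<close> by simp
  next
    case False
    then have S: "0 < S"
      using sum_nonneg[of A L] L unfolding S_def by force
    have conv: "convex_on {0..} (\<lambda>x::real. x powr r)"
      using \<open>1 \<le> r\<close> by (rule convex_on_powr_nonneg)
    have ne: "A \<noteq> {}"
      using False unfolding S_def by auto
    have jensen: "(\<Sum>n\<in>A. a n j) powr r \<le> (\<Sum>n\<in>A. L n / S * (S * a n j / L n) powr r)" if "j \<in> B" for j
    proof -
      have "(\<Sum>n\<in>A. a n j) = (\<Sum>n\<in>A. (L n / S) *\<^sub>R (S * a n j / L n))"
      proof (rule sum.cong)
        fix n assume "n \<in> A"
        then show "a n j = (L n / S) *\<^sub>R (S * a n j / L n)"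
          using zero[OF \<open>n \<in> A\<close> \<open>j \<in> B\<close>] S by (cases "L n = 0") auto
      qed simp
      moreover have "(\<Sum>n\<in>A. L n / S) = 1"
        using S by (simp add: S_def flip: sum_divide_distrib)
      ultimately show ?thesis
        using convex_on_sum[OF \<open>finite A\<close> ne conv, of "\<lambda>n. L n / S" "\<lambda>n. S * a n j / L n"] S L a that
        by simp
    qed
    have "(\<Sum>j\<in>B. (\<Sum>n\<in>A. a n j) powr r) \<le> (\<Sum>j\<in>B. \<Sum>n\<in>A. L n / S * (S * a n j / L n) powr r)"
      using jensen by (rule sum_mono)
    also have "\<dots> = (\<Sum>n\<in>A. \<Sum>j\<in>B. L n / S * (S * a n j / L n) powr r)"
      by (rule sum.swap)
    also have "\<dots> \<le> (\<Sum>n\<in>A. L n / S * (K * S powr r))"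
    proof (rule sum_mono)
      fix n assume n: "n \<in> A"
      show "(\<Sum>j\<in>B. L n / S * (S * a n j / L n) powr r) \<le> L n / S * (K * S powr r)"
      proof (cases "L n = 0")
        case False
        then have Ln: "0 < L n" using L[OF n] by simp
        have "(\<Sum>j\<in>B. (S * a n j / L n) powr r) = (S / L n) powr r * (\<Sum>j\<in>B. a n j powr r)"
          using S Ln a[OF n] by (simp add: sum_distrib_left powr_mult powr_divide)
        also have "\<dots> \<le> (S / L n) powr r * (K * L n powr r)"
          using le[OF n] by (rule mult_left_mono) simp
        also have "\<dots> = K * S powr r"
          using S Ln by (simp add: powr_divide)
        finally have "L n / S * (\<Sum>j\<in>B. (S * a n j / L n) powr r) \<le> L n / S * (K * S powr r)"
          using S Ln by (intro mult_left_mono) auto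
        then show ?thesis by (simp add: sum_distrib_left)
      qed simp
    qed
    also have "\<dots> = K * S powr r"
      using S by (simp add: S_def flip: sum_distrib_right sum_divide_distrib)
    finally show ?thesis unfolding S_def .
  qed
qed

lemma minkowski_series:
  fixes a :: "nat \<Rightarrow> nat \<Rightarrow> real" and L :: "nat \<Rightarrow> real"
  assumes r: "1 \<le> r" and a: "\<And>n j. 0 \<le> a n j" and L: "\<And>n. 0 \<le> L n" and K: "0 \<le> K"
    and sumL: "summable L" and suma: "\<And>j. summable (\<lambda>n. a n j)"
    and sumr: "\<And>n. summable (\<lambda>j. a n j powr r)"
    and le: "\<And>n. (\<Sum>j. a n j powr r) \<le> K * L n powr r"
  shows "summable (\<lambda>j. (\<Sum>n. a n j) powr r)"
    and "(\<Sum>j. (\<Sum>n. a n j) powr r) \<le> K * (\<Sum>n. L n) powr r"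
proof -
  have bound: "(\<Sum>j<J. (\<Sum>n. a n j) powr r) \<le> K * (\<Sum>n. L n) powr r" for J
  proof (rule LIMSEQ_le_const2)
    show "(\<lambda>N. \<Sum>j<J. (\<Sum>n<N. a n j) powr r) \<longlonglongrightarrow> (\<Sum>j<J. (\<Sum>n. a n j) powr r)"
      using suma[THEN summable_LIMSEQ] r a
      by (intro tendsto_sum tendsto_powr2) (auto intro!: tendsto_const always_eventually sum_nonneg)
    have "(\<Sum>j<J. (\<Sum>n<N. a n j) powr r) \<le> K * (\<Sum>n. L n) powr r" for N
    proof -
      have "(\<Sum>j<J. (\<Sum>n<N. a n j) powr r) \<le> K * (\<Sum>n<N. L n) powr r"
      proof (rule minkowski_finite)
        fix n
        have "(\<Sum>j<J. a n j powr r) \<le> (\<Sum>j. a n j powr r)"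
          using sumr by (intro sum_le_suminf) auto
        then show "(\<Sum>j<J. a n j powr r) \<le> K * L n powr r"
          using le[of n] by linarith
      qed (use r a L K in auto)
      also have "\<dots> \<le> K * (\<Sum>n. L n) powr r"
        using r K L sumL by (intro mult_left_mono powr_mono2 sum_le_suminf sum_nonneg) auto
      finally show ?thesis .
    qed
    then show "\<exists>N0. \<forall>N\<ge>N0. (\<Sum>j<J. (\<Sum>n<N. a n j) powr r) \<le> K * (\<Sum>n. L n) powr r"
      by blast
  qed
  show "summable (\<lambda>j. (\<Sum>n. a n j) powr r)"
    using bound by (intro summableI_nonneg_bounded[where x = "K * (\<Sum>n. L n) powr r"]) auto
  then show "(\<Sum>j. (\<Sum>n. a n j) powr r) \<le> K * (\<Sum>n. L n) powr r"
    using bound by (rule suminf_le_const)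
qed

section \<open>Functionals on a normed space\<close>

lemma pts_zero: "normed_space X \<Longrightarrow> 0 \<in> pts X"
  and pts_scl: "normed_space X \<Longrightarrow> x \<in> pts X \<Longrightarrow> scl X c x \<in> pts X"
  by (auto simp: normed_space_def module.subspace_def module_iff_vector_space)

lemma nrm_nonneg: "normed_space X \<Longrightarrow> x \<in> pts X \<Longrightarrow> 0 \<le> nrm X x"
  and nrm_eq_0_iff: "normed_space X \<Longrightarrow> x \<in> pts X \<Longrightarrow> nrm X x = 0 \<longleftrightarrow> x = 0"
  and nrm_scl: "normed_space X \<Longrightarrow> x \<in> pts X \<Longrightarrow> nrm X (scl X c x) = norm c * nrm X x"
  by (auto simp: normed_space_def)

lemma zero_in_unit_ball: "normed_space X \<Longrightarrow> 0 \<in> unit_ball X"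
  using nrm_eq_0_iff[of X 0] by (simp add: unit_ball_def pts_zero)

lemma mem_dual_iff:
  "\<phi> \<in> pts (dual X) \<longleftrightarrow>
     (\<forall>x. x \<notin> pts X \<longrightarrow> \<phi> x = 0) \<and>
     (\<forall>x\<in>pts X. \<forall>y\<in>pts X. \<phi> (x + y) = \<phi> x + \<phi> y) \<and>
     (\<forall>c. \<forall>x\<in>pts X. \<phi> (scl X c x) = c * \<phi> x) \<and>
     (\<exists>C. \<forall>x\<in>pts X. norm (\<phi> x) \<le> C * nrm X x)"
  by (simp add: dual_def bounded_ops_def scalar_space_def)

lemma scl_dual: "scl (dual X) c \<phi> = (\<lambda>x. c * \<phi> x)"
  by (simp add: dual_def)

lemma dual_zero: "normed_space X \<Longrightarrow> \<phi> \<in> pts (dual X) \<Longrightarrow> \<phi> 0 = 0"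
  unfolding mem_dual_iff by (metis add_cancel_left_left pts_zero)

lemma bdd_above_dual:
  assumes "normed_space X" "\<phi> \<in> pts (dual X)"
  shows "bdd_above ((\<lambda>x. norm (\<phi> x)) ` unit_ball X)"
proof -
  obtain C where C: "\<forall>x\<in>pts X. norm (\<phi> x) \<le> C * nrm X x"
    using assms(2) unfolding mem_dual_iff by auto
  show ?thesis
  proof (rule bdd_aboveI2)
    fix x assume x: "x \<in> unit_ball X"
    then have "norm (\<phi> x) \<le> C * nrm X x"
      using C by (auto simp: unit_ball_def)
    also have "\<dots> \<le> \<bar>C\<bar> * 1"
      using x nrm_nonneg[OF assms(1)] by (intro mult_mono) (auto simp: unit_ball_def)
    finally show "norm (\<phi> x) \<le> \<bar>C\<bar>" by simp
  qed
qed

lemma norm_le_nrm_dual: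
  assumes "normed_space X" "\<phi> \<in> pts (dual X)" "x \<in> unit_ball X"
  shows "norm (\<phi> x) \<le> nrm (dual X) \<phi>"
  using cSUP_upper[OF assms(3) bdd_above_dual[OF assms(1,2)]] by (simp add: dual_def)

lemma nrm_dual_le:
  assumes "normed_space X" "\<And>x. x \<in> unit_ball X \<Longrightarrow> norm (\<phi> x) \<le> C"
  shows "nrm (dual X) \<phi> \<le> C"
  using cSUP_least[of "unit_ball X" "\<lambda>x. norm (\<phi> x)" C] assms zero_in_unit_ball by (auto simp: dual_def)

lemma normalize_in_unit_ball:
  assumes "normed_space X" "x \<in> pts X" "nrm X x \<noteq> 0"
  shows "scl X (of_real (inverse (nrm X x))) x \<in> unit_ball X"
  using assms nrm_nonneg[OF assms(1,2)] by (simp add: unit_ball_def pts_scl nrm_scl norm_inverse)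

text \<open>
  The dual norm only looks at the unit ball; every other nonzero vector is a multiple of a vector in it.
\<close>

lemma norm_dual_apply_le:
  assumes X: "normed_space X" and \<phi>: "\<phi> \<in> pts (dual X)" and x: "x \<in> pts X"
  shows "norm (\<phi> x) \<le> nrm (dual X) \<phi> * nrm X x"
proof (cases "nrm X x = 0")
  case True
  then show ?thesis
    using X \<phi> x nrm_eq_0_iff dual_zero by fastforce
next
  case False
  then have pos: "0 < nrm X x"
    using nrm_nonneg[OF X x] by simp
  have "norm (\<phi> (scl X (of_real (inverse (nrm X x))) x)) \<le> nrm (dual X) \<phi>"
    using norm_le_nrm_dual[OF X \<phi> normalize_in_unit_ball[OF X x False]] .
  moreover have "\<phi> (scl X (of_real (inverse (nrm X x))) x) = of_real (inverse (nrm X x)) * \<phi> x"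
    using \<phi> x unfolding mem_dual_iff by blast
  ultimately show ?thesis
    using pos by (simp add: norm_mult norm_inverse inverse_eq_divide norm_divide divide_le_eq)
qed

text \<open>
  The norm separates functionals, as functions on the whole ambient type, because functionals are
  required to vanish outside the carrier.
\<close>

lemma normed_space_dual:
  fixes X :: "('k::{real_normed_field,euclidean_space}, 'v::ab_group_add) nspace"
  assumes X: "normed_space X"
  shows "normed_space (dual X)"
proof -
  have vs: "vector_space (scl (dual X))"
    unfolding vector_space_def scl_dual by (auto simp: fun_eq_iff algebra_simps)
  then have m: "module (scl (dual X))"
    by (simp add: module_iff_vector_space)
  have add: "\<phi> + \<psi> \<in> pts (dual X)" if "\<phi> \<in> pts (dual X)" "\<psi> \<in> pts (dual X)" for \<phi> \<psi>
  proof -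
    have "norm ((\<phi> + \<psi>) x) \<le> (nrm (dual X) \<phi> + nrm (dual X) \<psi>) * nrm X x" if "x \<in> pts X" for x
      using norm_dual_apply_le[OF X \<open>\<phi> \<in> _\<close> that] norm_dual_apply_le[OF X \<open>\<psi> \<in> _\<close> that]
        norm_triangle_ineq[of "\<phi> x" "\<psi> x"] by (simp add: algebra_simps)
    then have "\<exists>C. \<forall>x\<in>pts X. norm ((\<phi> + \<psi>) x) \<le> C * nrm X x"
      by blast
    then show ?thesis
      using that unfolding mem_dual_iff by (auto simp: algebra_simps)
  qed
  have scl: "scl (dual X) c \<phi> \<in> pts (dual X)" if "\<phi> \<in> pts (dual X)" for c \<phi>
  proof -
    have "norm (c * \<phi> x) \<le> (norm c * nrm (dual X) \<phi>) * nrm X x" if "x \<in> pts X" for x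
      using mult_left_mono[OF norm_dual_apply_le[OF X \<open>\<phi> \<in> _\<close> that], of "norm c"]
      by (simp add: norm_mult algebra_simps)
    then have "\<exists>C. \<forall>x\<in>pts X. norm (c * \<phi> x) \<le> C * nrm X x"
      by blast
    then show ?thesis
      using that unfolding mem_dual_iff scl_dual by (auto simp: algebra_simps)
  qed
  have "0 \<in> pts (dual X)"
    unfolding mem_dual_iff by (auto intro: exI[of _ 0])
  then have sub: "module.subspace (scl (dual X)) (pts (dual X))"
    using add scl by (simp add: module.subspace_def[OF m])
  have nonneg: "0 \<le> nrm (dual X) \<phi>" if "\<phi> \<in> pts (dual X)" for \<phi>
    using norm_le_nrm_dual[OF X that zero_in_unit_ball[OF X]] norm_ge_zero order_trans by blast
  have zero: "nrm (dual X) \<phi> = 0 \<longleftrightarrow> \<phi> = 0" if \<phi>: "\<phi> \<in> pts (dual X)" for \<phi>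
  proof
    assume "nrm (dual X) \<phi> = 0"
    then have "\<phi> x = 0" for x
      using norm_dual_apply_le[OF X \<phi>, of x] \<phi> unfolding mem_dual_iff by (cases "x \<in> pts X") auto
    then show "\<phi> = 0" by (simp add: fun_eq_iff)
  next
    assume "\<phi> = 0"
    then show "nrm (dual X) \<phi> = 0"
      using nonneg[OF \<phi>] nrm_dual_le[OF X, of \<phi> 0] by simp
  qed
  have triangle: "nrm (dual X) (\<phi> + \<psi>) \<le> nrm (dual X) \<phi> + nrm (dual X) \<psi>"
    if "\<phi> \<in> pts (dual X)" "\<psi> \<in> pts (dual X)" for \<phi> \<psi>
    using norm_le_nrm_dual[OF X that(1)] norm_le_nrm_dual[OF X that(2)]
    by (intro nrm_dual_le[OF X]) (auto intro: order_trans[OF norm_triangle_ineq] add_mono)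
  have le: "nrm (dual X) (scl (dual X) c \<phi>) \<le> norm c * nrm (dual X) \<phi>"
    if "\<phi> \<in> pts (dual X)" for c \<phi>
    using norm_le_nrm_dual[OF X that]
    by (intro nrm_dual_le[OF X]) (auto simp: scl_dual norm_mult mult_left_mono)
  have hom: "nrm (dual X) (scl (dual X) c \<phi>) = norm c * nrm (dual X) \<phi>"
    if \<phi>: "\<phi> \<in> pts (dual X)" for c \<phi>
  proof (cases "c = 0")
    case True
    then show ?thesis
      using le[OF \<phi>, of c] nonneg[OF scl[OF \<phi>], of c] by simp
  next
    case False
    have "scl (dual X) (inverse c) (scl (dual X) c \<phi>) = \<phi>"
      using False by (simp add: scl_dual fun_eq_iff)
    then have "nrm (dual X) \<phi> \<le> norm (inverse c) * nrm (dual X) (scl (dual X) c \<phi>)"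
      using le[OF scl[OF \<phi>], of "inverse c" c] by simp
    then have "norm c * nrm (dual X) \<phi> \<le> nrm (dual X) (scl (dual X) c \<phi>)"
      using False by (simp add: norm_divide inverse_eq_divide pos_le_divide_eq mult.commute)
    then show ?thesis
      using le[OF \<phi>, of c] by simp
  qed
  show ?thesis
    unfolding normed_space_def using vs sub nonneg zero triangle hom by blast
qed

section \<open>Weakly summable sequences\<close>

lemma le_powr_if_root_le:
  fixes a b p :: real
  assumes "a powr (1 / p) \<le> b" "0 \<le> a" "1 \<le> p"
  shows "a \<le> b powr p"
  using powr_mono2[of p "a powr (1 / p)" b] assms by (simp add: powr_powr)

lemma zero_in_weak_ball:
  assumes X: "normed_space X"
  shows "(\<lambda>j. 0) \<in> weak_ball p X"
proof -
  have z: "\<phi> 0 = 0" if "\<phi> \<in> unit_ball (dual X)" for \<phi>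
    using that dual_zero[OF X] by (simp add: unit_ball_def)
  have eq: "(\<lambda>\<phi>. (\<Sum>j::nat. norm (\<phi> 0) powr p) powr (1 / p)) ` unit_ball (dual X) = {0}"
    using z zero_in_unit_ball[OF normed_space_dual[OF X]] by force
  then show ?thesis
    using pts_zero[OF X] by (auto simp: weak_ball_def weak_lp_def weak_norm_def z)
qed

lemma weak_norm_upper:
  assumes "x \<in> weak_lp p X" "\<phi> \<in> unit_ball (dual X)"
  shows "(\<Sum>j. norm (\<phi> (x j)) powr p) powr (1 / p) \<le> weak_norm p X x"
  using assms unfolding weak_norm_def weak_lp_def by (auto intro: cSUP_upper)

lemma weak_norm_nonneg:
  assumes "normed_space X" "x \<in> weak_lp p X"
  shows "0 \<le> weak_norm p X x"
  using weak_norm_upper[OF assms(2) zero_in_unit_ball[OF normed_space_dual[OF assms(1)]]]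
    powr_ge_zero order_trans by blast

text \<open>
  Normalizing the functional brings it into the unit ball, where the weak norm applies.
\<close>

lemma weak_lp_functional:
  fixes X :: "('k::{real_normed_field,euclidean_space}, 'v::ab_group_add) nspace"
  assumes X: "normed_space X" and p: "1 \<le> p" and x: "x \<in> weak_lp p X" and \<phi>: "\<phi> \<in> pts (dual X)"
  shows "summable (\<lambda>j. norm (\<phi> (x j)) powr p)"
    and "(\<Sum>j. norm (\<phi> (x j)) powr p) \<le> (nrm (dual X) \<phi> * weak_norm p X x) powr p"
proof -
  define t where "t = nrm (dual X) \<phi>"
  note X' = normed_space_dual[OF X]
  have "summable (\<lambda>j. norm (\<phi> (x j)) powr p) \<and>
    (\<Sum>j. norm (\<phi> (x j)) powr p) \<le> (t * weak_norm p X x) powr p"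
  proof (cases "t = 0")
    case True
    then have "\<phi> = 0"
      using nrm_eq_0_iff[OF X' \<phi>] by (simp add: t_def)
    then show ?thesis by simp
  next
    case False
    then have t: "0 < t"
      using nrm_nonneg[OF X' \<phi>] by (simp add: t_def)
    define \<psi> where "\<psi> = scl (dual X) (of_real (inverse t)) \<phi>"
    have \<psi>: "\<psi> \<in> unit_ball (dual X)"
      using normalize_in_unit_ball[OF X' \<phi>] False by (simp add: \<psi>_def t_def)
    have sum: "summable (\<lambda>j. norm (\<psi> (x j)) powr p)"
      using x \<psi> by (simp add: weak_lp_def)
    have "(\<Sum>j. norm (\<psi> (x j)) powr p) \<le> weak_norm p X x powr p"
      using weak_norm_upper[OF x \<psi>] p sum by (intro le_powr_if_root_le suminf_nonneg) auto
    then have le: "t powr p * (\<Sum>j. norm (\<psi> (x j)) powr p) \<le> (t * weak_norm p X x) powr p"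
      using t weak_norm_nonneg[OF X x] by (simp add: powr_mult mult_left_mono)
    have eq: "norm (\<phi> (x j)) powr p = t powr p * norm (\<psi> (x j)) powr p" for j
      using t by (simp add: \<psi>_def scl_dual norm_mult norm_inverse powr_mult powr_divide inverse_eq_divide norm_divide)
    show ?thesis
      using sum le by (simp add: eq suminf_mult summable_mult)
  qed
  then show "summable (\<lambda>j. norm (\<phi> (x j)) powr p)"
    and "(\<Sum>j. norm (\<phi> (x j)) powr p) \<le> (nrm (dual X) \<phi> * weak_norm p X x) powr p"
    by (auto simp: t_def)
qed

definition finite_weak_norm ::
  "real \<Rightarrow> ('k::{real_normed_field,euclidean_space}, 'v::ab_group_add) nspace \<Rightarrow> nat \<Rightarrow> (nat \<Rightarrow> 'v) \<Rightarrow> real" where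
  "finite_weak_norm p X m x =
     (SUP \<phi>\<in>unit_ball (dual X). (\<Sum>j<m. norm (\<phi> (x j)) powr p) powr (1 / p))"

text \<open>
  The real-valued supremum is only meaningful once it is bounded; the strong norm
  \<open>(\<Sum>j<m. \<parallel>x j\<parallel>\<^sup>p)\<close> to the power \<open>1 / p\<close> is a bound.
\<close>

lemma finite_weak_norm_upper:
  assumes X: "normed_space X" and p: "1 \<le> p" and x: "\<forall>j<m. x j \<in> pts X" and \<phi>: "\<phi> \<in> unit_ball (dual X)"
  shows "(\<Sum>j<m. norm (\<phi> (x j)) powr p) powr (1 / p) \<le> finite_weak_norm p X m x"
  unfolding finite_weak_norm_def
proof (rule cSUP_upper[OF \<phi>], rule bdd_aboveI2)
  fix \<psi> assume \<psi>: "\<psi> \<in> unit_ball (dual X)"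
  have "norm (\<psi> (x j)) \<le> nrm X (x j)" if "j < m" for j
  proof -
    have "norm (\<psi> (x j)) \<le> nrm (dual X) \<psi> * nrm X (x j)"
      using norm_dual_apply_le[OF X, of \<psi> "x j"] x \<psi> that by (simp add: unit_ball_def)
    also have "\<dots> \<le> 1 * nrm X (x j)"
      using \<psi> nrm_nonneg[OF X] x that by (intro mult_right_mono) (auto simp: unit_ball_def)
    finally show ?thesis by simp
  qed
  then show "(\<Sum>j<m. norm (\<psi> (x j)) powr p) powr (1 / p) \<le> (\<Sum>j<m. nrm X (x j) powr p) powr (1 / p)"
    using p by (intro powr_mono2 sum_mono sum_nonneg) auto
qed

lemma finite_weak_norm_le_weak_norm:
  assumes X: "normed_space X" and p: "1 \<le> p" and x: "x \<in> weak_lp p X"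
  shows "finite_weak_norm p X m x \<le> weak_norm p X x"
  unfolding finite_weak_norm_def
proof (rule cSUP_least)
  show "unit_ball (dual X) \<noteq> {}"
    using zero_in_unit_ball[OF normed_space_dual[OF X]] by auto
  fix \<phi> assume \<phi>: "\<phi> \<in> unit_ball (dual X)"
  have "(\<Sum>j<m. norm (\<phi> (x j)) powr p) powr (1 / p) \<le> (\<Sum>j. norm (\<phi> (x j)) powr p) powr (1 / p)"
    using x \<phi> p by (intro powr_mono2 sum_le_suminf sum_nonneg) (auto simp: weak_lp_def)
  also have "\<dots> \<le> weak_norm p X x"
    by (rule weak_norm_upper[OF x \<phi>])
  finally show "(\<Sum>j<m. norm (\<phi> (x j)) powr p) powr (1 / p) \<le> weak_norm p X x" .
qed

section \<open>The summing norm\<close>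

text \<open>
  Countably many sequences, arranged as the rows of an infinite matrix, are enumerated as a single
  sequence by Cantor's pairing function. Any initial segment of the enumeration lies in a finite
  square of the matrix, whose sum is controlled by the geometric series.
\<close>

lemma weak_lp_concat_blocks:
  assumes X: "normed_space X" and p: "1 \<le> p" and pts: "\<And>k j. y k j \<in> pts X"
    and block: "\<And>k J \<phi>. \<phi> \<in> unit_ball (dual X) \<Longrightarrow> (\<Sum>j<J. norm (\<phi> (y k j)) powr p) \<le> (1/2)^k"
  shows "(\<lambda>n. case_prod y (prod_decode n)) \<in> weak_lp p X"
proof -
  let ?z = "\<lambda>n. case_prod y (prod_decode n)"
  have bound: "(\<Sum>n<N. norm (\<phi> (?z n)) powr p) \<le> 2" if \<phi>: "\<phi> \<in> unit_ball (dual X)" for \<phi> N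
  proof -
    let ?g = "\<lambda>(k, j). norm (\<phi> (y k j)) powr p"
    have fin: "finite (prod_decode ` {..<N})" by simp
    obtain K where K: "\<And>q. q \<in> prod_decode ` {..<N} \<Longrightarrow> fst q < K \<and> snd q < K"
    proof -
      obtain K1 where "\<forall>i\<in>fst ` prod_decode ` {..<N}. i < K1"
        using fin finite_nat_set_iff_bounded by (meson finite_imageI)
      moreover obtain K2 where "\<forall>i\<in>snd ` prod_decode ` {..<N}. i < K2"
        using fin finite_nat_set_iff_bounded by (meson finite_imageI)
      ultimately have "fst q < max K1 K2 \<and> snd q < max K1 K2" if "q \<in> prod_decode ` {..<N}" for q
        using that by (auto simp: less_max_iff_disj)
      then show thesis by (rule that)
    qed
    have "(\<Sum>n<N. norm (\<phi> (?z n)) powr p) = (\<Sum>n<N. ?g (prod_decode n))"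
      by (simp add: case_prod_beta)
    also have "\<dots> = sum ?g (prod_decode ` {..<N})"
      by (simp add: sum.reindex inj_prod_decode o_def)
    also have "\<dots> \<le> sum ?g ({..<K} \<times> {..<K})"
      using K by (intro sum_mono2) force+
    also have "\<dots> = (\<Sum>k<K. \<Sum>j<K. norm (\<phi> (y k j)) powr p)"
      by (simp add: sum.cartesian_product)
    also have "\<dots> \<le> (\<Sum>k<K. (1/2)^k)"
      using block[OF \<phi>] by (rule sum_mono)
    also have "\<dots> \<le> 2"
      by (simp add: sum_gp_strict)
    finally show ?thesis .
  qed
  have sum: "summable (\<lambda>n. norm (\<phi> (?z n)) powr p)" if "\<phi> \<in> unit_ball (dual X)" for \<phi>
    using bound[OF that] by (intro summableI_nonneg_bounded[where x = 2]) auto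
  have "bdd_above ((\<lambda>\<phi>. (\<Sum>n. norm (\<phi> (?z n)) powr p) powr (1 / p)) ` unit_ball (dual X))"
  proof (rule bdd_aboveI2)
    fix \<phi> assume \<phi>: "\<phi> \<in> unit_ball (dual X)"
    show "(\<Sum>n. norm (\<phi> (?z n)) powr p) powr (1 / p) \<le> 2 powr (1 / p)"
      using p suminf_le_const[OF sum[OF \<phi>] bound[OF \<phi>]] sum[OF \<phi>]
      by (intro powr_mono2 suminf_nonneg) auto
  qed
  then show ?thesis
    using pts sum by (simp add: weak_lp_def case_prod_beta)
qed

text \<open>
  A gliding hump argument. If no constant works, then for every \<open>k\<close> there is a finite family for which
  the constant \<open>2 ^ k\<close> fails. Dividing it by the left-hand side of the inequality makes the
  \<open>p\<close>-th powers of the norms of its image sum to 1, while its weak norm drops below the inverse of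
  \<open>2 ^ k\<close>. Concatenating these families yields a weakly \<open>p\<close>-summable sequence whose image contains infinitely many blocks of sum 1. Scaling by
  the left-hand side, which is positive, avoids dividing by the weak norm, which might be 0.
\<close>

lemma abs_summing_finite_inequality:
  fixes X :: "('k::{real_normed_field,euclidean_space}, 'v::ab_group_add) nspace"
    and Y :: "('k, 'w::ab_group_add) nspace"
  assumes X: "normed_space X" and Y: "normed_space Y" and p: "1 \<le> p" and u: "abs_summing p X Y u"
  shows "\<exists>C\<ge>0. \<forall>m x. (\<forall>j<m. x j \<in> pts X) \<longrightarrow>
    (\<Sum>j<m. nrm Y (u (x j)) powr p) powr (1 / p) \<le> C * finite_weak_norm p X m x"
proof (rule ccontr)
  assume contra: "\<not> ?thesis"
  have ops: "u \<in> bounded_ops X Y"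
    using u by (simp add: abs_summing_def)
  define hump where "hump k m y \<longleftrightarrow> (\<forall>j. y j \<in> pts X) \<and>
      (\<forall>\<phi>\<in>unit_ball (dual X). \<forall>J. (\<Sum>j<J. norm (\<phi> (y j)) powr p) \<le> (1/2)^k) \<and>
      (\<Sum>j<m. nrm Y (u (y j)) powr p) = 1" for k m :: nat and y :: "nat \<Rightarrow> 'v"
  have "\<exists>m y. hump k m y" for k
  proof -
    have "(0::real) \<le> 2^k" by simp
    then obtain m x where x: "\<forall>j<m. x j \<in> pts X"
      and gt: "2^k * finite_weak_norm p X m x < (\<Sum>j<m. nrm Y (u (x j)) powr p) powr (1 / p)"
      using contra by (meson not_le)
    define S where "S = (\<Sum>j<m. nrm Y (u (x j)) powr p)"
    define s where "s = S powr (1 / p)"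
    have "0 \<le> S" unfolding S_def by (simp add: sum_nonneg)
    have upper: "(\<Sum>j<m. norm (\<phi> (x j)) powr p) powr (1 / p) \<le> s / 2^k"
      if "\<phi> \<in> unit_ball (dual X)" for \<phi>
    proof -
      have "2^k * (\<Sum>j<m. norm (\<phi> (x j)) powr p) powr (1 / p) \<le> 2^k * finite_weak_norm p X m x"
        using finite_weak_norm_upper[OF X p x that] by simp
      also have "\<dots> \<le> s"
        using gt by (simp add: s_def S_def)
      finally show ?thesis
        by (simp add: pos_le_divide_eq mult.commute)
    qed
    have "0 \<le> finite_weak_norm p X m x"
      using finite_weak_norm_upper[OF X p x zero_in_unit_ball[OF normed_space_dual[OF X]]]
        powr_ge_zero order_trans by blast
    then have "0 \<le> 2^k * finite_weak_norm p X m x" by simp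
    then have s: "0 < s"
      using gt unfolding s_def S_def by linarith
    have sp: "s powr p = S"
      using p \<open>0 \<le> S\<close> by (simp add: s_def powr_powr)
    define c :: 'k where "c = of_real (inverse s)"
    have c: "norm c = inverse s"
      using s by (simp add: c_def norm_inverse)
    define y where "y j = (if j < m then scl X c (x j) else 0)" for j
    have "y j \<in> pts X" for j
      using x pts_scl[OF X] pts_zero[OF X] by (simp add: y_def)
    moreover have "(\<Sum>j<J. norm (\<phi> (y j)) powr p) \<le> (1/2)^k" if \<phi>: "\<phi> \<in> unit_ball (dual X)" for \<phi> J
    proof -
      have \<phi>': "\<phi> \<in> pts (dual X)" using \<phi> by (simp add: unit_ball_def)
      have "\<phi> (y j) = (if j < m then c * \<phi> (x j) else 0)" for j
        using \<phi>' x dual_zero[OF X \<phi>'] unfolding mem_dual_iff by (simp add: y_def)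
      then have "norm (\<phi> (y j)) powr p = (if j < m then norm (\<phi> (x j)) powr p / S else 0)" for j
        using s p sp by (simp add: norm_mult c powr_mult powr_divide inverse_eq_divide flip: sp)
      then have "(\<Sum>j<J. norm (\<phi> (y j)) powr p) = (\<Sum>j\<in>{..<J} \<inter> {..<m}. norm (\<phi> (x j)) powr p / S)"
        by (simp add: sum.inter_restrict)
      also have "\<dots> \<le> (\<Sum>j<m. norm (\<phi> (x j)) powr p / S)"
        using \<open>0 \<le> S\<close> by (intro sum_mono2) auto
      also have "\<dots> = (\<Sum>j<m. norm (\<phi> (x j)) powr p) / s powr p"
        by (simp add: sp flip: sum_divide_distrib)
      also have "\<dots> \<le> (s / 2^k) powr p / s powr p"
        using upper[OF \<phi>] p s by (intro divide_right_mono le_powr_if_root_le sum_nonneg) auto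
      also have "\<dots> = ((1/2)^k) powr p"
        using s by (simp add: powr_divide power_divide)
      also have "\<dots> \<le> ((1/2)^k) powr 1"
        using p by (intro powr_mono') (auto simp: power_le_one)
      finally show ?thesis by simp
    qed
    moreover have "(\<Sum>j<m. nrm Y (u (y j)) powr p) = 1"
    proof -
      have "nrm Y (u (y j)) powr p = nrm Y (u (x j)) powr p / S" if "j < m" for j
      proof -
        have "x j \<in> pts X" "u (x j) \<in> pts Y"
          using x that ops by (auto simp: bounded_ops_def)
        moreover have "u (scl X c (x j)) = scl Y c (u (x j))"
          using \<open>x j \<in> pts X\<close> ops by (auto simp: bounded_ops_def)
        ultimately show ?thesis
          using that s nrm_nonneg[OF Y] by (simp add: y_def nrm_scl[OF Y] c powr_mult powr_divide inverse_eq_divide flip: sp)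
      qed
      then have "(\<Sum>j<m. nrm Y (u (y j)) powr p) = (\<Sum>j<m. nrm Y (u (x j)) powr p / S)"
        by simp
      also have "\<dots> = S / S"
        by (simp add: S_def flip: sum_divide_distrib)
      finally have "(\<Sum>j<m. nrm Y (u (y j)) powr p) = S / S" .
      moreover have "S \<noteq> 0"
        using s by (auto simp: s_def)
      ultimately show ?thesis
        by simp
    qed
    ultimately have "hump k m y"
      by (simp add: hump_def)
    then show ?thesis by blast
  qed
  then obtain m y where hump: "\<And>k. hump k (m k) (y k)"
    by metis
  have pts: "\<And>k j. y k j \<in> pts X"
    and block: "\<And>k J \<phi>. \<phi> \<in> unit_ball (dual X) \<Longrightarrow> (\<Sum>j<J. norm (\<phi> (y k j)) powr p) \<le> (1/2)^k"
    and one: "\<And>k. (\<Sum>j<m k. nrm Y (u (y k j)) powr p) = 1"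
    using hump by (auto simp: hump_def)
  let ?z = "\<lambda>n. case_prod y (prod_decode n)"
  have sum: "summable (\<lambda>n. nrm Y (u (?z n)) powr p)"
    using weak_lp_concat_blocks[of X p y, OF X p pts block] u by (simp add: abs_summing_def)
  \<comment> \<open>The first \<open>K\<close> blocks alone contribute \<open>K\<close>.\<close>
  have "real K \<le> (\<Sum>n. nrm Y (u (?z n)) powr p)" for K
  proof -
    let ?R = "Sigma {..<K} (\<lambda>k. {..<m k})"
    have "real K = (\<Sum>k<K. \<Sum>j<m k. nrm Y (u (y k j)) powr p)"
      by (simp add: one)
    also have "\<dots> = (\<Sum>(k, j)\<in>?R. nrm Y (u (y k j)) powr p)"
      by (simp add: sum.Sigma)
    also have "\<dots> = (\<Sum>n\<in>prod_encode ` ?R. nrm Y (u (?z n)) powr p)"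
      by (simp add: sum.reindex inj_prod_encode case_prod_beta)
    also have "\<dots> \<le> (\<Sum>n. nrm Y (u (?z n)) powr p)"
      using sum by (intro sum_le_suminf) auto
    finally show ?thesis .
  qed
  then show False
    using reals_Archimedean2 not_le by blast
qed

text \<open>
  Each partial sum is bounded by every admissible constant, hence by their infimum; there is at least
  one such constant by \<open>abs_summing_finite_inequality\<close>, and the bound passes to the limit.
\<close>

lemma summing_norm_bound:
  fixes X :: "('k::{real_normed_field,euclidean_space}, 'v::ab_group_add) nspace"
    and Y :: "('k, 'w::ab_group_add) nspace"
  assumes X: "normed_space X" and Y: "normed_space Y" and p: "1 \<le> p" and u: "abs_summing p X Y u"
    and x: "x \<in> weak_ball p X"
  shows "(\<Sum>n. nrm Y (u (x n)) powr p) powr (1 / p) \<le> summing_norm p X Y u"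
proof -
  have lp: "x \<in> weak_lp p X" and w: "weak_norm p X x \<le> 1"
    using x by (auto simp: weak_ball_def)
  have pts: "x j \<in> pts X" for j
    using lp by (simp add: weak_lp_def)
  let ?A = "{C. 0 \<le> C \<and> (\<forall>m x. (\<forall>j<m. x j \<in> pts X) \<longrightarrow>
    (\<Sum>j<m. nrm Y (u (x j)) powr p) powr (1 / p) \<le> C * finite_weak_norm p X m x)}"
  have norm: "summing_norm p X Y u = Inf ?A"
    by (simp add: summing_norm_def finite_weak_norm_def)
  have ne: "?A \<noteq> {}"
    using abs_summing_finite_inequality[OF X Y p u] by blast
  have partial: "(\<Sum>n<N. nrm Y (u (x n)) powr p) powr (1 / p) \<le> summing_norm p X Y u" for N
    unfolding norm
  proof (rule cInf_greatest[OF ne])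
    fix C assume C: "C \<in> ?A"
    then have "(\<Sum>n<N. nrm Y (u (x n)) powr p) powr (1 / p) \<le> C * finite_weak_norm p X N x"
      using pts by blast
    also have "\<dots> \<le> C * 1"
      using C w finite_weak_norm_le_weak_norm[OF X p lp, of N] by (intro mult_left_mono) auto
    finally show "(\<Sum>n<N. nrm Y (u (x n)) powr p) powr (1 / p) \<le> C" by simp
  qed
  have sum: "summable (\<lambda>n. nrm Y (u (x n)) powr p)"
    using u lp by (simp add: abs_summing_def)
  have "(\<lambda>N. (\<Sum>n<N. nrm Y (u (x n)) powr p) powr (1 / p)) \<longlonglongrightarrow> (\<Sum>n. nrm Y (u (x n)) powr p) powr (1 / p)"
    using summable_LIMSEQ[OF sum] p by (intro tendsto_powr2) (auto intro!: always_eventually sum_nonneg)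
  then show ?thesis
    using partial by (intro LIMSEQ_le_const2) auto
qed

section \<open>Weakly mid summing operators\<close>

text \<open>
  This is the heart of the matter: Minkowski's inequality with exponent \<open>s / p\<close> for the sequences
  \<open>j \<mapsto> \<bar>f n (x j)\<bar>\<^sup>p\<close>. Their \<open>s / p\<close>-th powers are \<open>\<bar>f n (x j)\<bar>\<^sup>s\<close>, whose sum over \<open>j\<close> is bounded by the weak norm
  of \<open>x\<close> and the norm of \<open>f n\<close>.
\<close>

lemma mixed_norm_functionals:
  fixes X :: "('k::{real_normed_field,euclidean_space}, 'v::ab_group_add) nspace"
  assumes X: "normed_space X" and p: "1 \<le> p" and s: "p \<le> s" and x: "x \<in> weak_lp s X"
    and f: "\<And>n. f n \<in> pts (dual X)" and sumf: "summable (\<lambda>n. nrm (dual X) (f n) powr p)"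
  shows "summable (\<lambda>n. norm (f n (x j)) powr p)"
    and "summable (\<lambda>j. (\<Sum>n. norm (f n (x j)) powr p) powr (s / p))"
    and "(\<Sum>j. (\<Sum>n. norm (f n (x j)) powr p) powr (s / p)) powr (1 / s)
      \<le> (\<Sum>n. nrm (dual X) (f n) powr p) powr (1 / p) * weak_norm s X x"
proof -
  define W where "W = weak_norm s X x"
  have W: "0 \<le> W"
    using weak_norm_nonneg[OF X x] by (simp add: W_def)
  have nn: "0 \<le> nrm (dual X) (f n)" for n
    using nrm_nonneg[OF normed_space_dual[OF X] f] .
  have s1: "1 \<le> s" using p s by simp
  have pts: "x j \<in> pts X" for j
    using x by (simp add: weak_lp_def)
  show sumn: "summable (\<lambda>n. norm (f n (x j)) powr p)" for j
  proof (rule summable_comparison_test'[of "\<lambda>n. nrm X (x j) powr p * nrm (dual X) (f n) powr p" 0])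
    show "summable (\<lambda>n. nrm X (x j) powr p * nrm (dual X) (f n) powr p)"
      using sumf by (rule summable_mult)
    fix n
    have "norm (f n (x j)) powr p \<le> (nrm (dual X) (f n) * nrm X (x j)) powr p"
      using norm_dual_apply_le[OF X f pts] p by (intro powr_mono2) auto
    then show "norm (norm (f n (x j)) powr p) \<le> nrm X (x j) powr p * nrm (dual X) (f n) powr p"
      using nn nrm_nonneg[OF X pts] by (simp add: powr_mult mult.commute)
  qed
  have pow: "(norm (f n (x j)) powr p) powr (s / p) = norm (f n (x j)) powr s" for n j
    using p by (simp add: powr_powr)
  have sumj: "summable (\<lambda>j. (norm (f n (x j)) powr p) powr (s / p))" for n
    unfolding pow by (rule weak_lp_functional(1)[OF X s1 x f])
  have le: "(\<Sum>j. (norm (f n (x j)) powr p) powr (s / p)) \<le> W powr s * (nrm (dual X) (f n) powr p) powr (s / p)" for n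
    using weak_lp_functional(2)[OF X s1 x f, of n] nn W p unfolding pow W_def[symmetric]
    by (simp add: powr_powr powr_mult mult.commute)
  have r: "1 \<le> s / p" using p s by simp
  note mink = minkowski_series[OF r _ _ _ sumf sumn sumj le, OF powr_ge_zero powr_ge_zero powr_ge_zero]
  show summ: "summable (\<lambda>j. (\<Sum>n. norm (f n (x j)) powr p) powr (s / p))"
    by (rule mink(1))
  have "(\<Sum>j. (\<Sum>n. norm (f n (x j)) powr p) powr (s / p)) powr (1 / s)
    \<le> (W powr s * (\<Sum>n. nrm (dual X) (f n) powr p) powr (s / p)) powr (1 / s)"
    using mink(2) s1 summ by (intro powr_mono2 suminf_nonneg) auto
  also have "\<dots> = (\<Sum>n. nrm (dual X) (f n) powr p) powr (1 / p) * W"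
    using W s1 p by (simp add: powr_mult powr_powr)
  finally show "(\<Sum>j. (\<Sum>n. norm (f n (x j)) powr p) powr (s / p)) powr (1 / s)
      \<le> (\<Sum>n. nrm (dual X) (f n) powr p) powr (1 / p) * weak_norm s X x"
    unfolding W_def .
qed

theorem theorem5p1:
  fixes E :: "('k::{real_normed_field,euclidean_space}, 'a::ab_group_add) nspace"
    and F :: "('k, 'b::ab_group_add) nspace"
    and T :: "'a \<Rightarrow> 'b"
    and p :: real
  assumes "banach_space E" and "banach_space F"
    and "1 \<le> p"
    and "T \<in> bounded_ops E F"
    and "abs_summing p (dual F) (dual E) (adjoint_op F T)"
  shows "\<forall>s\<ge>p. T \<in> weakly_mid_summing s p s E F \<and>
           weakly_mid_norm s p s E F T \<le> summing_norm p (dual F) (dual E) (adjoint_op F T)"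
proof (intro allI impI)
  fix s assume s: "p \<le> s"
  let ?u = "adjoint_op F T"
  let ?pi = "summing_norm p (dual F) (dual E) ?u"
  have E: "normed_space E" and F: "normed_space F"
    using assms(1,2) by (auto simp: banach_space_def)
  note p = \<open>1 \<le> p\<close> and u = assms(5)
  have pts: "T (x j) \<in> pts F" if "x \<in> weak_lp s E" for x and j :: nat
    using assms(4) that by (simp add: bounded_ops_def weak_lp_def)
  have adj: "?u (\<psi> n) \<in> pts (dual E)" and apply_adj: "?u (\<psi> n) v = \<psi> n (T v)"
    and sum: "summable (\<lambda>n. nrm (dual E) (?u (\<psi> n)) powr p)"
    if "\<psi> \<in> weak_lp p (dual F)" for \<psi> n v
  proof -
    have "\<psi> n \<in> pts (dual F)" for n
      using that by (simp add: weak_lp_def)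
    then show "?u (\<psi> n) \<in> pts (dual E)" "?u (\<psi> n) v = \<psi> n (T v)"
      using u by (auto simp: abs_summing_def bounded_ops_def adjoint_op_def)
    show "summable (\<lambda>n. nrm (dual E) (?u (\<psi> n)) powr p)"
      using u that by (simp add: abs_summing_def)
  qed
  have "(\<lambda>j. T (x j)) \<in> mid_lp s p F" if "x \<in> weak_lp s E" for x
    unfolding mid_lp_def
    using that pts mixed_norm_functionals(1,2)[OF E p s that adj sum] by (auto simp: apply_adj)
  then have "T \<in> weakly_mid_summing s p s E F"
    using assms(4) by (simp add: weakly_mid_summing_def)
  moreover have "weakly_mid_norm s p s E F T \<le> ?pi"
    unfolding weakly_mid_norm_def
  proof (rule cSUP_least)
    show "weak_ball s E \<noteq> {}"
      using zero_in_weak_ball[OF E] by auto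
    fix x assume "x \<in> weak_ball s E"
    then have x: "x \<in> weak_lp s E" and wx: "weak_norm s E x \<le> 1"
      by (auto simp: weak_ball_def)
    show "mid_norm s p F (\<lambda>j. T (x j)) \<le> ?pi"
      unfolding mid_norm_def
    proof (rule cSUP_least)
      show "weak_ball p (dual F) \<noteq> {}"
        using zero_in_weak_ball[OF normed_space_dual[OF F]] by auto
      fix \<psi> assume \<psi>: "\<psi> \<in> weak_ball p (dual F)"
      then have lp: "\<psi> \<in> weak_lp p (dual F)"
        by (simp add: weak_ball_def)
      have "(\<Sum>j. (\<Sum>n. norm (\<psi> n (T (x j))) powr p) powr (s / p)) powr (1 / s)
          \<le> (\<Sum>n. nrm (dual E) (?u (\<psi> n)) powr p) powr (1 / p) * weak_norm s E x"
        using mixed_norm_functionals(3)[OF E p s x adj[OF lp] sum[OF lp]] by (simp add: apply_adj[OF lp])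
      also have "\<dots> \<le> (\<Sum>n. nrm (dual E) (?u (\<psi> n)) powr p) powr (1 / p) * 1"
        using wx by (intro mult_left_mono) auto
      also have "\<dots> \<le> ?pi"
        using summing_norm_bound[OF normed_space_dual[OF F] normed_space_dual[OF E] p u \<psi>] by simp
      finally show "(\<Sum>j. (\<Sum>n. norm (\<psi> n (T (x j))) powr p) powr (s / p)) powr (1 / s) \<le> ?pi" .
    qed
  qed
  ultimately show "T \<in> weakly_mid_summing s p s E F \<and> weakly_mid_norm s p s E F T \<le> ?pi" ..
qed

end
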